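(* Let $\theta\in(0,\pi/2)$ be a constant, let $\Phi=\{z=re^{i\theta}: r\in[r_0,\infty)\}$, and let $\varepsilon>0$ be a small constant. For $z=x+iy\in\Phi$ define $$\mathbf{H}=\int_{0}^{y}e^{-e^{x}\cos t}\,e^{-ie^{x}\sin t}\,dt .$$ Then there is a constant $\xi=\xi(\varepsilon)>0$ dependent on $\varepsilon$ such that, for all $z=x+iy\in\Phi$ such that $y=2\mathbf{k}\pi+\pi+\eta$ with a large integer $\mathbf{k}>0$ and a number $\eta\in[-\pi/2+\varepsilon,\pi/2-\varepsilon]$, $$|\mathbf{H}|>\xi\,\frac{e^{e^{x}\cos\eta}}{e^{x}\cos\eta}.$$
   Context: Here $r_0>0$ is a fixed number; for $z=x+iy\in\Phi$ one has $y=x\tan\theta$. "Large integer $\mathbf{k}$" means that the assertion holds for all sufficiently large positive integers $\mathbf{k}$. *)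

theory Defs
  imports "HOL-Analysis.Analysis"
begin

definition Phi :: "real \<Rightarrow> real \<Rightarrow> complex set" where
  "Phi \<theta> r0 = {of_real r * exp (\<i> * of_real \<theta>) | r. r0 \<le> r}"

text \<open>
  The interval \<open>{0..Im z}\<close> represents the oriented range of integration only for \<open>Im z \<ge> 0\<close>,
  which holds on \<open>Phi \<theta> r0\<close> for \<open>0 < \<theta> < pi / 2\<close> and \<open>r0 > 0\<close>.
\<close>

definition H :: "complex \<Rightarrow> complex" where
  "H z = integral {0..Im z}
     (\<lambda>t. of_real (exp (- exp (Re z) * cos t)) * exp (- \<i> * of_real (exp (Re z) * sin t)))"

end

theory Submission
  imports Defs "HOL-Complex_Analysis.Complex_Analysis" "HOL-Real_Asymp.Real_Asymp"
begin

text \<open>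
  Put \<open>R = exp (Re z)\<close>. The integrand of \<open>H z\<close> is \<open>exp (- R * cis t)\<close>, which is periodic in \<open>t\<close>
  with integral \<open>2 * pi\<close> over a period, by Cauchy's formula on the circle of radius \<open>R\<close>. Let
  \<open>K s\<close> be its integral over \<open>{0..s}\<close>. For \<open>Im z = 2 * k * pi + pi + \<eta>\<close> and \<open>s = pi - \<bar>\<eta>\<bar>\<close>,
  periodicity gives \<open>H z = 2 * pi * k + K s\<close> if \<open>\<eta> \<le> 0\<close>, and the symmetry \<open>t \<mapsto> 2 * pi - t\<close> gives
  \<open>H z = 2 * pi * (k + 1) - cnj (K s)\<close> if \<open>\<eta> > 0\<close>. This avoids integrating across \<open>t = pi\<close>, where
  the integrand has modulus \<open>exp R\<close> and so dwarfs its value at the endpoint.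

  On \<open>{0..s}\<close> the modulus \<open>exp (- R * cos t)\<close> increases. Integration by parts gives a
  boundary term of modulus \<open>exp (- R * cos s) / R\<close> and a remainder at most \<open>1 / R\<close> times the
  integral of the modulus. That integral concentrates at the endpoint: it is at most half of
  \<open>exp (- R * cos s)\<close> when \<open>R\<close> is large, uniformly in \<open>s \<in> {pi / 2..pi}\<close>
  (lemmas \<open>integral_modulus_le\<close> and \<open>norm_integral_exp_circle_ge\<close>). Hence \<open>norm (K s)\<close> is at least
  about \<open>exp (R * cos \<eta>) / (2 * R)\<close>. The integer multiple of \<open>2 * pi\<close> is at most
  \<open>Re z * tan \<theta> + 2 * pi\<close>, hence at most of the order of \<open>ln R\<close>, while \<open>cos \<eta> \<ge> sin \<epsilon> > 0\<close>, so
  it is negligible and \<open>\<xi> = sin \<epsilon> / 4\<close> works for \<open>\<epsilon> \<le> pi / 2\<close>; for larger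
  \<open>\<epsilon>\<close> the range of \<open>\<eta>\<close> is empty.
\<close>

section \<open>The integrand as an exponential on a circle\<close>

text \<open>The integrand of \<open>H\<close>, with \<open>exp (Re z)\<close> replaced by a parameter \<open>R\<close>.\<close>

definition exp_circle :: "real \<Rightarrow> real \<Rightarrow> complex" where
  "exp_circle R t = exp (- (of_real R * cis t))"

lemma H_eq_integral_exp_circle: "H z = integral {0..Im z} (exp_circle (exp (Re z)))"
proof -
  have "of_real (exp (- exp (Re z) * cos t)) * exp (- \<i> * of_real (exp (Re z) * sin t))
          = exp_circle (exp (Re z)) t" for t
    unfolding exp_circle_def exp_of_real [symmetric] exp_add [symmetric]
    by (rule arg_cong[of _ _ exp]) (auto simp: complex_eq_iff simp flip: exp_of_real)
  then show ?thesis
    by (simp add: H_def)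
qed

lemma norm_exp_circle: "norm (exp_circle R t) = exp (- R * cos t)"
  by (simp add: exp_circle_def norm_exp_eq_Re)

lemma continuous_on_exp_circle [continuous_intros]: "continuous_on S (exp_circle R)"
  unfolding exp_circle_def by (intro continuous_intros)

lemma integrable_exp_circle: "exp_circle R integrable_on {a..b}"
  by (intro integrable_continuous_real continuous_intros)

lemma exp_circle_add_2pi: "exp_circle R (t + 2 * pi) = exp_circle R t"
  by (simp add: exp_circle_def cis.ctr)

lemma exp_circle_2pi_minus: "exp_circle R (2 * pi - t) = cnj (exp_circle R t)"
proof -
  have "cis (2 * pi - t) = cnj (cis t)"
    by (simp add: complex_eq_iff cos_diff sin_diff)
  then show ?thesis
    by (simp add: exp_circle_def exp_cnj)
qed

section \<open>Reduction to at most half a period\<close>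

lemma has_integral_exp_circle_period:
  assumes "R > 0"
  shows "(exp_circle R has_integral 2 * of_real pi) {0..2 * pi}"
proof -
  have "((\<lambda>u. exp (- u) / (u - 0)) has_contour_integral 2 * of_real pi * \<i> * exp (- 0))
          (circlepath 0 R)"
    by (rule Cauchy_integral_circlepath) (use assms in \<open>auto intro!: continuous_intros holomorphic_intros\<close>)
  then have "((\<lambda>t. exp (- (R * cis t)) / (R * cis t) * R * \<i> * cis t)
      has_integral 2 * of_real pi * \<i>) {0..2 * pi}"
    by (simp add: circlepath_def has_contour_integral_part_circlepath_iff)
  then have "((\<lambda>t. exp_circle R t * \<i>) has_integral 2 * of_real pi * \<i>) {0..2 * pi}"
    using assms by (simp add: exp_circle_def)
  from has_integral_mult_left [OF this, of "- \<i>"] show ?thesis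
    by (simp add: mult.assoc)
qed

lemma integral_exp_circle_add_period:
  assumes "R > 0" "s \<ge> 0"
  shows "integral {0..2 * pi + s} (exp_circle R) = 2 * of_real pi + integral {0..s} (exp_circle R)"
proof -
  have "integral {0..2 * pi + s} (exp_circle R)
      = integral {0..2 * pi} (exp_circle R) + integral {2 * pi..2 * pi + s} (exp_circle R)"
    using assms integrable_exp_circle by (simp add: Henstock_Kurzweil_Integration.integral_combine)
  also have "integral {2 * pi..2 * pi + s} (exp_circle R) = integral {0..s} (exp_circle R)"
    using integral_shift_real_ivl[of "2 * pi" "2 * pi" "2 * pi + s" "exp_circle R"]
    by (simp add: exp_circle_add_2pi)
  finally show ?thesis
    using has_integral_exp_circle_period[OF assms(1)] by (simp add: integral_unique)
qed

lemma integral_exp_circle_add_periods: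
  assumes "R > 0" "s \<ge> 0"
  shows "integral {0..2 * real n * pi + s} (exp_circle R)
           = of_real (2 * real n * pi) + integral {0..s} (exp_circle R)"
proof (induction n)
  case (Suc n)
  have "2 * real (Suc n) * pi + s = 2 * pi + (2 * real n * pi + s)"
    by (simp add: algebra_simps)
  then show ?case
    using integral_exp_circle_add_period[of R "2 * real n * pi + s"] assms Suc
    by (simp add: algebra_simps)
qed simp

lemma integral_exp_circle_2pi_minus:
  assumes "R > 0" "0 \<le> s" "s \<le> 2 * pi"
  shows "integral {0..2 * pi - s} (exp_circle R)
           = 2 * of_real pi - cnj (integral {0..s} (exp_circle R))"
proof -
  have "integral {2 * pi - s..2 * pi} (exp_circle R) = integral {-s..0} (\<lambda>t. exp_circle R (t + 2 * pi))"
    using integral_shift_real_ivl[of "2 * pi - s" "2 * pi" "2 * pi" "exp_circle R"] by simp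
  also have "\<dots> = integral {0..s} (\<lambda>t. exp_circle R (2 * pi - t))"
    using Henstock_Kurzweil_Integration.integral_reflect_real[of s 0 "\<lambda>t. exp_circle R (2 * pi - t)"]
    by (simp only: minus_zero diff_minus_eq_add add.commute)
  also have "\<dots> = cnj (integral {0..s} (exp_circle R))"
    by (simp add: exp_circle_2pi_minus integral_cnj)
  finally have "integral {2 * pi - s..2 * pi} (exp_circle R) = cnj (integral {0..s} (exp_circle R))" .
  moreover have "integral {0..2 * pi - s} (exp_circle R) + integral {2 * pi - s..2 * pi} (exp_circle R)
      = 2 * of_real pi"
    using assms integrable_exp_circle integral_unique[OF has_integral_exp_circle_period]
    by (simp add: Henstock_Kurzweil_Integration.integral_combine)
  ultimately show ?thesis
    by (simp add: algebra_simps)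
qed

section \<open>Lower bound for the integral over at most half a period\<close>

text \<open>
  The modulus of the integrand is bounded by its value at \<open>s\<close> on \<open>{s - \<delta>..s}\<close> and is exponentially
  smaller than that on \<open>{0..s - \<delta>}\<close>.
\<close>

lemma integral_modulus_le:
  assumes R: "R > 0" and d: "0 < \<delta>" "\<delta> \<le> pi / 2" and s: "pi / 2 \<le> s" "s \<le> pi"
  shows "integral {0..s} (\<lambda>t. exp (- R * cos t))
           \<le> (\<delta> + pi * exp (- 2 * R * (sin (\<delta> / 2))\<^sup>2)) * exp (- R * cos s)"
proof -
  let ?f = "\<lambda>t. exp (- R * cos t)" and ?q = "exp (- 2 * R * (sin (\<delta> / 2))\<^sup>2)"
  have int: "?f integrable_on {a..b}" for a b
    by (intro integrable_continuous_real continuous_intros)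
  \<comment> \<open>Write \<open>cos t - cos s\<close> as a product of sines; both arguments lie in \<open>{\<delta> / 2..pi - \<delta> / 2}\<close>.\<close>
  have far: "?f t \<le> ?q * ?f s" if t: "t \<in> {0..s - \<delta>}" for t
  proof -
    have "sin (\<delta> / 2) \<le> sin ((s - t) / 2)"
      by (rule sin_monotone_2pi_le) (use t d s pi_gt_zero in auto)
    moreover have "sin (\<delta> / 2) \<le> sin ((s + t) / 2)"
    proof (cases "(s + t) / 2 \<le> pi / 2")
      case True
      show ?thesis
        by (rule sin_monotone_2pi_le) (use True t d s pi_gt_zero in auto)
    next
      case False
      have "sin (\<delta> / 2) \<le> sin (pi - (s + t) / 2)"
        by (rule sin_monotone_2pi_le) (use False t d s in \<open>auto simp: field_simps\<close>)
      then show ?thesis by simp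
    qed
    moreover have "sin (\<delta> / 2) \<ge> 0"
      by (rule sin_ge_zero) (use d pi_gt_zero in auto)
    ultimately have "sin (\<delta> / 2) * sin (\<delta> / 2) \<le> sin ((s + t) / 2) * sin ((s - t) / 2)"
      by (intro mult_mono) auto
    moreover have "cos t - cos s = 2 * (sin ((s + t) / 2) * sin ((s - t) / 2))"
      using cos_diff_cos[of t s] by (simp add: add.commute)
    ultimately have "2 * (sin (\<delta> / 2))\<^sup>2 \<le> cos t - cos s"
      by (simp add: power2_eq_square)
    then have "R * (2 * (sin (\<delta> / 2))\<^sup>2) \<le> R * (cos t - cos s)"
      using R by (intro mult_left_mono) auto
    then show ?thesis
      by (simp add: algebra_simps flip: exp_add)
  qed
  have near: "?f t \<le> ?f s" if t: "t \<in> {s - \<delta>..s}" for t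
    using R t d s by (auto intro!: mult_left_mono cos_monotone_0_pi_le)
  have "integral {0..s} ?f = integral {0..s - \<delta>} ?f + integral {s - \<delta>..s} ?f"
    using d s by (intro Henstock_Kurzweil_Integration.integral_combine [symmetric] int) auto
  also have "integral {0..s - \<delta>} ?f \<le> integral {0..s - \<delta>} (\<lambda>t. ?q * ?f s)"
    by (intro integral_le int far) auto
  also have "\<dots> = (s - \<delta>) * (?q * ?f s)"
    using d s by simp
  also have "\<dots> \<le> pi * (?q * ?f s)"
    using d s by (intro mult_right_mono) auto
  also have "integral {s - \<delta>..s} ?f \<le> integral {s - \<delta>..s} (\<lambda>t. ?f s)"
    by (intro integral_le int near) auto
  also have "\<dots> = \<delta> * ?f s"
    using d by simp
  finally show ?thesis
    by (simp add: algebra_simps)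
qed

text \<open>
  The function \<open>?F\<close> below satisfies \<open>?F' t = exp_circle R t + cis (- t) * exp_circle R t / R\<close>, so it is
  an antiderivative of the integrand up to a relative error of modulus \<open>1 / R\<close>.
\<close>

lemma integral_exp_circle_by_parts:
  assumes "R > 0" "s \<ge> 0"
  shows "integral {0..s} (exp_circle R)
           = \<i> / of_real R * cis (- s) * exp_circle R s - \<i> / of_real R * exp_circle R 0
             - 1 / of_real R * integral {0..s} (\<lambda>t. cis (- t) * exp_circle R t)"
proof -
  let ?F = "\<lambda>t. \<i> / of_real R * cis (- t) * exp_circle R t"
  have der: "(?F has_vector_derivative
      exp_circle R t + 1 / of_real R * (cis (- t) * exp_circle R t)) (at t within {0..s})" for t
  proof -
    have "((\<lambda>w. \<i> / of_real R * exp (- (\<i> * w)) * exp (- (of_real R * exp (\<i> * w))))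
        has_field_derivative
          exp_circle R t + 1 / of_real R * (cis (- t) * exp_circle R t)) (at (of_real t))"
      using assms
      by (auto intro!: derivative_eq_intros
          simp: exp_circle_def cis_conv_exp field_simps simp flip: exp_add)
    from has_vector_derivative_real_field [OF this] show ?thesis
      by (simp add: exp_circle_def cis_conv_exp)
  qed
  have "((\<lambda>t. exp_circle R t + 1 / of_real R * (cis (- t) * exp_circle R t)) has_integral ?F s - ?F 0) {0..s}"
    by (rule fundamental_theorem_of_calculus) (use assms der in auto)
  moreover have "(\<lambda>t. cis (- t) * exp_circle R t) integrable_on {0..s}"
    by (intro integrable_continuous_real continuous_intros)
  ultimately have "?F s - ?F 0 = integral {0..s} (exp_circle R)
      + 1 / of_real R * integral {0..s} (\<lambda>t. cis (- t) * exp_circle R t)"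
    using integrable_exp_circle[of R 0 s]
    by (subst integral_mult_right [symmetric], subst integral_add [symmetric])
       (auto intro!: integrable_on_mult_right integrable_on_divide simp: integral_unique)
  then show ?thesis
    by (simp add: algebra_simps)
qed

text \<open>
  The hypothesis \<open>small\<close>, which holds for all large \<open>R\<close>, makes the remainder at most half of the
  boundary term at \<open>s\<close>.
\<close>

lemma norm_integral_exp_circle_ge:
  assumes R: "R > 0" and s: "pi / 2 \<le> s" "s \<le> pi"
    and small: "pi * exp (- 2 * R * (sin (1 / 8))\<^sup>2) \<le> 1 / 4"
  shows "norm (integral {0..s} (exp_circle R)) \<ge> exp (- R * cos s) / (2 * R) - 1 / R"
proof -
  let ?E = "exp (- R * cos s)"
  have s0: "s \<ge> 0"
    using s pi_gt_zero by linarith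
  let ?A = "\<i> / of_real R * cis (- s) * exp_circle R s" and ?B = "\<i> / of_real R * exp_circle R 0"
  let ?C = "1 / of_real R * integral {0..s} (\<lambda>t. cis (- t) * exp_circle R t)"
  have "norm ?A = ?E / R"
    using R by (simp add: norm_mult norm_divide norm_exp_circle)
  moreover have "norm ?B \<le> 1 / R"
    using R by (simp add: norm_mult norm_divide norm_exp_circle divide_right_mono)
  moreover have "norm ?C \<le> ?E / (2 * R)"
  proof -
    have "norm (integral {0..s} (\<lambda>t. cis (- t) * exp_circle R t))
        \<le> integral {0..s} (\<lambda>t. exp (- R * cos t))"
      by (intro integral_norm_bound_integral integrable_continuous_real continuous_intros)
         (simp add: norm_mult norm_exp_circle)
    \<comment> \<open>The width \<open>\<delta>\<close> of the final interval is taken to be \<open>1 / 4\<close>.\<close>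
    also have "\<dots> \<le> (1 / 4 + pi * exp (- 2 * R * (sin (1 / 8))\<^sup>2)) * ?E"
      using integral_modulus_le[of R "1 / 4" s] R s pi_gt3 by simp
    also have "\<dots> \<le> 1 / 2 * ?E"
      using small by (intro mult_right_mono) auto
    finally show ?thesis
      using R by (simp add: norm_mult norm_divide field_simps)
  qed
  moreover have "norm (?A - ?B - ?C) \<ge> norm ?A - norm ?B - norm ?C"
    using norm_triangle_ineq2[of ?A ?B] norm_triangle_ineq2[of "?A - ?B" ?C] by linarith
  ultimately have "norm (?A - ?B - ?C) \<ge> ?E / R - 1 / R - ?E / (2 * R)"
    by linarith
  moreover have "?E / R = ?E / (2 * R) + ?E / (2 * R)"
    by (simp add: field_simps)
  ultimately show ?thesis
    using integral_exp_circle_by_parts[OF R s0] by simp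
qed

section \<open>The integral up to a point near an odd multiple of \<open>pi\<close>\<close>

lemma norm_integral_exp_circle_odd_pi_ge:
  assumes R: "R > 0" and \<eta>: "\<bar>\<eta>\<bar> \<le> pi / 2"
    and small: "pi * exp (- 2 * R * (sin (1 / 8))\<^sup>2) \<le> 1 / 4"
  shows "norm (integral {0..2 * real k * pi + pi + \<eta>} (exp_circle R))
           \<ge> exp (R * cos \<eta>) / (2 * R) - 1 / R - (2 * real k * pi + 2 * pi)"
proof -
  define s where "s = pi - \<bar>\<eta>\<bar>"
  let ?I = "integral {0..2 * real k * pi + pi + \<eta>} (exp_circle R)"
  let ?K = "integral {0..s} (exp_circle R)"
  have s: "pi / 2 \<le> s" "s \<le> pi"
    using \<eta> by (auto simp: s_def)
  have "cos s = - cos \<eta>"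
    by (simp add: s_def cos_diff)
  then have K: "norm ?K \<ge> exp (R * cos \<eta>) / (2 * R) - 1 / R"
    using norm_integral_exp_circle_ge[OF R s small] by simp
  have "norm ?I \<ge> norm ?K - (2 * real k * pi + 2 * pi)"
  proof (cases "\<eta> \<le> 0")
    case True
    then have "?I = of_real (2 * real k * pi) + ?K"
      using integral_exp_circle_add_periods[OF R, of s k] s pi_gt_zero by (simp add: s_def add.assoc)
    then have "norm ?I \<ge> norm ?K - norm (complex_of_real (2 * real k * pi))"
      using norm_diff_ineq[of ?K "of_real (2 * real k * pi)"] by (simp only: add.commute)
    moreover have "norm (complex_of_real (2 * real k * pi)) = 2 * real k * pi"
      unfolding norm_of_real by simp
    ultimately show ?thesis
      using pi_gt_zero by linarith
  next
    case False
    then have "2 * real k * pi + pi + \<eta> = 2 * real k * pi + (2 * pi - s)"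
      by (simp add: s_def)
    moreover have "integral {0..2 * real k * pi + (2 * pi - s)} (exp_circle R)
        = of_real (2 * real k * pi + 2 * pi) - cnj ?K"
      using integral_exp_circle_add_periods[OF R, of "2 * pi - s" k]
        integral_exp_circle_2pi_minus[OF R, of s] s pi_gt_zero
      by simp
    ultimately have "norm ?I \<ge> norm (cnj ?K) - norm (complex_of_real (2 * real k * pi + 2 * pi))"
      by (metis norm_minus_commute norm_triangle_ineq2)
    moreover have "norm (complex_of_real (2 * real k * pi + 2 * pi)) = 2 * real k * pi + 2 * pi"
      unfolding norm_of_real by simp
    ultimately show ?thesis
      by simp
  qed
  with K show ?thesis by linarith
qed

section \<open>Comparison of growth rates along the ray\<close>

lemma Im_eq_Re_mult_tan:
  assumes "z \<in> Phi \<theta> r0" "cos \<theta> \<noteq> 0"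
  shows "Im z = Re z * tan \<theta>"
proof -
  obtain r where "z = of_real r * exp (\<i> * of_real \<theta>)"
    using assms(1) by (auto simp: Phi_def)
  then have "z = of_real r * cis \<theta>"
    by (simp add: cis_conv_exp)
  then show ?thesis
    using assms(2) by (simp add: tan_def)
qed

lemma eventually_exp_dominates:
  fixes a b c :: real
  assumes "a > 0"
  shows "\<forall>\<^sub>F R in at_top. 4 + 4 * R * (R * b + c) < exp (R * a)"
  using assms by real_asymp

lemma eventually_exp_decay:
  fixes a b c :: real
  assumes "a > 0" "c > 0"
  shows "\<forall>\<^sub>F R in at_top. b * exp (- 2 * R * a) \<le> c"
proof -
  have "((\<lambda>R. b * exp (- 2 * R * a)) \<longlongrightarrow> 0) at_top"
    using assms(1) by real_asymp
  from order_tendstoD(2)[OF this assms(2)] show ?thesis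
    by (rule eventually_mono) simp
qed

theorem theorem3p1:
  fixes \<epsilon> :: real
  assumes "\<epsilon> > 0"
  shows "\<exists>\<xi>>0. \<forall>\<theta> r0 :: real. 0 < \<theta> \<and> \<theta> < pi / 2 \<and> r0 > 0 \<longrightarrow>
    (\<forall>\<^sub>F k :: nat in sequentially.
       \<forall>\<eta> \<in> {- pi / 2 + \<epsilon> .. pi / 2 - \<epsilon>}. \<forall>z \<in> Phi \<theta> r0.
         Im z = 2 * real k * pi + pi + \<eta> \<longrightarrow>
         norm (H z) > \<xi> * (exp (exp (Re z) * cos \<eta>) / (exp (Re z) * cos \<eta>)))"
proof (cases "\<epsilon> \<le> pi / 2")
  case False
  \<comment> \<open>The range of \<open>\<eta>\<close> is empty.\<close>
  then have "{- pi / 2 + \<epsilon> .. pi / 2 - \<epsilon>} = {}"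
    by simp
  then show ?thesis
    by (intro exI[of _ 1]) (simp only: ball_empty, simp)
next
  case True
  define a where "a = sin \<epsilon>"
  have a: "a > 0"
    unfolding a_def using assms True pi_gt_zero by (intro sin_gt_zero) linarith+
  show ?thesis
  proof (intro exI[of _ "a / 4"] conjI allI impI)
    fix \<theta> r0 :: real
    assume *: "0 < \<theta> \<and> \<theta> < pi / 2 \<and> r0 > 0"
    then have tan: "tan \<theta> > 0" and cos\<theta>: "cos \<theta> > 0"
      by (auto intro!: tan_gt_zero cos_gt_zero)
    have "sin (1 / 8 :: real) > 0"
      using pi_gt3 by (intro sin_gt_zero) auto
    then have "\<forall>\<^sub>F R in at_top. pi * exp (- 2 * R * (sin (1 / 8))\<^sup>2) \<le> 1 / 4"
      by (intro eventually_exp_decay) auto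
    moreover have "\<forall>\<^sub>F R in at_top. 4 + 4 * R * (R * tan \<theta> + 2 * pi) < exp (R * a)"
      using a by (rule eventually_exp_dominates)
    ultimately have "\<forall>\<^sub>F R in at_top. pi * exp (- 2 * R * (sin (1 / 8))\<^sup>2) \<le> 1 / 4 \<and>
        4 + 4 * R * (R * tan \<theta> + 2 * pi) < exp (R * a)"
      by (rule eventually_conj)
    then obtain N where N:
      "\<And>R. R \<ge> N \<Longrightarrow> pi * exp (- 2 * R * (sin (1 / 8))\<^sup>2) \<le> 1 / 4"
      "\<And>R. R \<ge> N \<Longrightarrow> 4 + 4 * R * (R * tan \<theta> + 2 * pi) < exp (R * a)"
      unfolding eventually_at_top_linorder by blast
    \<comment> \<open>Once \<open>N * tan \<theta> \<le> 2 * k * pi\<close>, every admissible \<open>z\<close> has \<open>Re z \<ge> N\<close>,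
      because \<open>2 * k * pi \<le> Im z = Re z * tan \<theta>\<close>.\<close>
    have "filterlim (\<lambda>k. 2 * real k * pi) at_top sequentially"
      by real_asymp
    then have "\<forall>\<^sub>F k in sequentially. N * tan \<theta> \<le> 2 * real k * pi"
      by (simp add: filterlim_at_top)
    then show "\<forall>\<^sub>F k :: nat in sequentially.
       \<forall>\<eta> \<in> {- pi / 2 + \<epsilon> .. pi / 2 - \<epsilon>}. \<forall>z \<in> Phi \<theta> r0.
         Im z = 2 * real k * pi + pi + \<eta> \<longrightarrow>
         norm (H z) > a / 4 * (exp (exp (Re z) * cos \<eta>) / (exp (Re z) * cos \<eta>))"
    proof (rule eventually_mono, intro ballI impI)
      fix k :: nat and \<eta> :: real and z
      assume k: "N * tan \<theta> \<le> 2 * real k * pi" and \<eta>: "\<eta> \<in> {- pi / 2 + \<epsilon> .. pi / 2 - \<epsilon>}"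
        and z: "z \<in> Phi \<theta> r0" and Im: "Im z = 2 * real k * pi + pi + \<eta>"
      define R where "R = exp (Re z)"
      define E where "E = exp (R * cos \<eta>)"
      have R: "R > 0" and ReR: "Re z \<le> R"
        using exp_ge_add_one_self[of "Re z"] unfolding R_def by (simp, linarith)
      have ztan: "Im z = Re z * tan \<theta>"
        using z cos\<theta> by (intro Im_eq_Re_mult_tan) auto
      have abs\<eta>: "\<bar>\<eta>\<bar> \<le> pi / 2 - \<epsilon>"
        using \<eta> by auto
      have k_le: "2 * real k * pi \<le> Re z * tan \<theta>"
        using abs\<eta> assms Im pi_gt_zero unfolding ztan by linarith
      with k have "N * tan \<theta> \<le> Re z * tan \<theta>"
        by linarith
      with tan have "N \<le> R"
        using ReR by simp
      note N = N[OF this]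
      have cos_ge: "cos \<eta> \<ge> a"
      proof -
        have "cos (pi / 2 - \<epsilon>) \<le> cos \<bar>\<eta>\<bar>"
          using abs\<eta> assms pi_gt_zero by (intro cos_monotone_0_pi_le) linarith+
        then show ?thesis
          by (simp add: a_def sin_cos_eq)
      qed
      have "4 + 4 * R * (R * tan \<theta> + 2 * pi) < exp (R * a)"
        by (fact N)
      also have "\<dots> \<le> E"
        using cos_ge R by (simp add: E_def)
      finally have "4 + 4 * R * (R * tan \<theta> + 2 * pi) < E" .
      then have "(4 + 4 * R * (R * tan \<theta> + 2 * pi)) / (4 * R) < E / (4 * R)"
        using R by (intro divide_strict_right_mono) auto
      then have "1 / R + (R * tan \<theta> + 2 * pi) < E / (4 * R)"
        using R by (simp add: add_divide_distrib)
      moreover have "2 * real k * pi \<le> R * tan \<theta>"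
        using k_le mult_right_mono[OF ReR, of "tan \<theta>"] tan by linarith
      moreover have "norm (H z) \<ge> E / (2 * R) - 1 / R - (2 * real k * pi + 2 * pi)"
        using norm_integral_exp_circle_odd_pi_ge[OF R _ N(1), of \<eta> k] abs\<eta> assms
        by (simp add: H_eq_integral_exp_circle Im R_def E_def)
      moreover have "E / (2 * R) = E / (4 * R) + E / (4 * R)"
        by (simp add: field_simps)
      ultimately have "norm (H z) > E / (4 * R)"
        by linarith
      moreover have "a / 4 * (E / (R * cos \<eta>)) \<le> E / (4 * R)"
      proof -
        have "a / cos \<eta> \<le> 1"
          using a cos_ge by simp
        then have "a / cos \<eta> * (E / (4 * R)) \<le> 1 * (E / (4 * R))"
          using R by (intro mult_right_mono) (auto simp: E_def)
        then show ?thesis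
          by (simp add: ac_simps)
      qed
      ultimately show "norm (H z) > a / 4 * (exp (exp (Re z) * cos \<eta>) / (exp (Re z) * cos \<eta>))"
        by (simp add: E_def R_def)
    qed
  qed (use a in simp)
qed

end
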